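(* Let $q$ be a power of $2$. Both the minimum distance and the stopping distance of the binary code $\mathcal{C}(2,q)$ (with respect to the parity-check matrix $H(2,q)$) are $4q$.
   Context: $\mathbb{S}_2(\mathbb{F}_q)$ denotes the set of $2\times 2$ symmetric matrices over $\mathbb{F}_q$ (its elements are called points). Two points $S,S'$ are adjacent if $\operatorname{rank}(S-S')=1$. A line is a maximal set of rank $1$: a subset $\mathcal{M}\subseteq\mathbb{S}_2(\mathbb{F}_q)$ such that any two distinct points of $\mathcal{M}$ are adjacent and no point of $\mathbb{S}_2(\mathbb{F}_q)\setminus\mathcal{M}$ is adjacent to every point of $\mathcal{M}$. $H(2,q)$ is the binary matrix with rows indexed by the lines and columns indexed by the points, whose (line, point) entry is $1$ iff the point belongs to the line. $\mathcal{C}(2,q)=\{c\in\mathbb{F}_2^{\text{points}}: H(2,q)c=0\}$. A stopping set is a set $T$ of coordinate positions such that no row of $H(2,q)$ has exactly one $1$ among the positions in $T$; the stopping distance is the minimum size of a nonempty stopping set. *)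

theory Defs
  imports "HOL-Analysis.Analysis" "HOL-Library.Z2"
begin

definition sym_points :: "('a::field ^ 2 ^ 2) set" where
  "sym_points = {S. transpose S = S}"

definition adjacent :: "'a::field ^ 2 ^ 2 \<Rightarrow> 'a ^ 2 ^ 2 \<Rightarrow> bool" where
  "adjacent S S' \<longleftrightarrow> rank (S - S') = 1"

definition is_line :: "('a::field ^ 2 ^ 2) set \<Rightarrow> bool" where
  "is_line M \<longleftrightarrow> M \<subseteq> sym_points \<and>
     (\<forall>S\<in>M. \<forall>S'\<in>M. S \<noteq> S' \<longrightarrow> adjacent S S') \<and>
     \<not> (\<exists>P\<in>sym_points - M. \<forall>S\<in>M. adjacent P S)"

text \<open>
  A binary matrix with rows indexed by a set \<open>R\<close> and columns indexed by a finite set \<open>N\<close>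
  is a function \<open>H\<close> of two arguments, of which only the values on \<open>R\<close> and \<open>N\<close> matter.
  Words over the index set \<open>N\<close> are extensional functions, so that two words are equal iff
  they agree on \<open>N\<close>.
\<close>

definition parity_check_code ::
    "('r \<Rightarrow> 'n \<Rightarrow> bit) \<Rightarrow> 'r set \<Rightarrow> 'n set \<Rightarrow> ('n \<Rightarrow> bit) set" where
  "parity_check_code H R N = {c \<in> N \<rightarrow>\<^sub>E UNIV. \<forall>r\<in>R. (\<Sum>j\<in>N. H r j * c j) = 0}"

definition hamming_dist :: "'n set \<Rightarrow> ('n \<Rightarrow> bit) \<Rightarrow> ('n \<Rightarrow> bit) \<Rightarrow> nat" where
  "hamming_dist N c d = card {j \<in> N. c j \<noteq> d j}"

text \<open>
  The two minima below are meaningful only if the sets are nonempty; \<^const>\<open>Min\<close> of the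
  empty set is unspecified.
\<close>

definition min_distance :: "'n set \<Rightarrow> ('n \<Rightarrow> bit) set \<Rightarrow> nat" where
  "min_distance N C = Min {hamming_dist N c d | c d. c \<in> C \<and> d \<in> C \<and> c \<noteq> d}"

definition stopping_set ::
    "('r \<Rightarrow> 'n \<Rightarrow> bit) \<Rightarrow> 'r set \<Rightarrow> 'n set \<Rightarrow> 'n set \<Rightarrow> bool" where
  "stopping_set H R N T \<longleftrightarrow> T \<subseteq> N \<and> (\<forall>r\<in>R. card {j \<in> T. H r j = 1} \<noteq> 1)"

definition stopping_distance ::
    "('r \<Rightarrow> 'n \<Rightarrow> bit) \<Rightarrow> 'r set \<Rightarrow> 'n set \<Rightarrow> nat" where
  "stopping_distance H R N = Min {card T | T. stopping_set H R N T \<and> T \<noteq> {}}"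

definition H2 :: "('a::field ^ 2 ^ 2) set \<Rightarrow> 'a ^ 2 ^ 2 \<Rightarrow> bit" where
  "H2 M P = (if P \<in> M then 1 else 0)"

definition C2 :: "('a::field ^ 2 ^ 2 \<Rightarrow> bit) set" where
  "C2 = parity_check_code H2 {M. is_line M} sym_points"

end

theory Submission
  imports Defs "HOL-Number_Theory.Residues"
begin

text \<open>
  Rank-1 symmetric matrices are the multiples of squares of vectors, so the lines are the affine
  lines in \<open>q + 1\<close> directions, and the geometry has no triangles. In characteristic 2,
  adjacency of \<open>S\<close> and \<open>S'\<close> reads
  \<open>det S + det S' + S\<^sub>1\<^sub>1 S'\<^sub>2\<^sub>2 + S'\<^sub>1\<^sub>1 S\<^sub>2\<^sub>2 = 0\<close>, which is bilinear in
  \<open>(1, S\<^sub>1\<^sub>1, S\<^sub>2\<^sub>2, det S)\<close>: the points form a part of the symplectic quadrangle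
  \<open>W(q)\<close>, all of whose points are regular.

  Let \<open>T\<close> be a nonempty stopping set. If \<open>T\<close> contains no quadrangle, the points
  at distance at most 2 from a point of \<open>T\<close> give \<open>card T \<ge> (q + 1)\<^sup>2 \<ge> 4 q\<close>. Otherwise,
  let \<open>A\<close> and \<open>B\<close> be the sets of common neighbours in \<open>T\<close> of the two diagonals of a quadrangle, of
  sizes \<open>a\<close> and \<open>b\<close> in \<open>{2..q}\<close>. By regularity every point of \<open>A\<close> is adjacent to every
  point of \<open>B\<close>, and the lines through exactly one point of \<open>A \<union> B\<close> contain further points of
  \<open>T\<close>, all distinct, so that
  \<open>card T \<ge> a + b + b (q + 1 - a) + a (q + 1 - b) = 4 q + (a - 2) (q - b) + (b - 2) (q - a)\<close>.

  The bound is attained by an additive subgroup of order \<open>4 q\<close> containing a nonzero matrix in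
  every direction: it meets each line in an even number of points.
\<close>

section \<open>Rank, determinant and adjacency of 2x2 matrices\<close>

text \<open>Rank is the dimension of the row span: it is 2 exactly for nonzero determinant and 0
  exactly for the zero matrix, which leaves 1 for the rest.\<close>

lemma rank_2x2_eq_1_iff:
  fixes A :: "'a::field ^ 2 ^ 2"
  shows "rank A = 1 \<longleftrightarrow> A \<noteq> 0 \<and> det A = 0"
proof -
  have "det A \<noteq> 0 \<longleftrightarrow> vec.span (rows A) = UNIV"
    by (metis invertible_det_nz invertible_left_inverse matrix_left_invertible_span_rows_gen)
  also have "\<dots> \<longleftrightarrow> rank A = 2"
    by (simp add: row_rank_def_gen vec.dimension_def card_cart_basis flip: vec.dim_eq_full)
  finally have full: "det A \<noteq> 0 \<longleftrightarrow> rank A = 2" .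
  have "rows A \<subseteq> {0} \<longleftrightarrow> (\<forall>i. row i A = 0)"
    by (auto simp: rows_def)
  then have "rank A = 0 \<longleftrightarrow> A = 0"
    by (simp add: row_rank_def_gen row_def vec_eq_iff)
  moreover have "rank A \<le> 2"
    using vec.dim_subset_UNIV[of "rows A"]
    by (simp add: row_rank_def_gen vec.dimension_def card_cart_basis)
  ultimately show ?thesis
    using full by linarith
qed

lemma det_2x2_diff_commute:
  fixes S S' :: "'a::field ^ 2 ^ 2"
  shows "det (S - S') = det (S' - S)"
  by (simp add: det_2 algebra_simps)

lemma adjacent_iff_det:
  fixes S S' :: "'a::field ^ 2 ^ 2"
  shows "adjacent S S' \<longleftrightarrow> S' \<noteq> S \<and> det (S' - S) = 0"
  unfolding adjacent_def rank_2x2_eq_1_iff by (auto simp: det_2x2_diff_commute[of S S'])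

lemma adjacent_sym: "adjacent S S' \<longleftrightarrow> adjacent S' S"
  by (auto simp: adjacent_iff_det det_2x2_diff_commute[of S S'])

section \<open>Coordinates, rays and directions\<close>

definition sym_mat :: "'a::field \<Rightarrow> 'a \<Rightarrow> 'a \<Rightarrow> 'a ^ 2 ^ 2" where
  "sym_mat a b c = vector [vector [a, b], vector [b, c]]"

lemma sym_mat_nth [simp]:
  "sym_mat a b c $ 1 $ 1 = a" "sym_mat a b c $ 1 $ 2 = b"
  "sym_mat a b c $ 2 $ 1 = b" "sym_mat a b c $ 2 $ 2 = c"
  by (simp_all add: sym_mat_def)

lemma sym_mat_eq_iff: "sym_mat a b c = sym_mat a' b' c' \<longleftrightarrow> a = a' \<and> b = b' \<and> c = c'"
  by (auto simp: sym_mat_def vec_eq_iff forall_2)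

lemma sym_points_iff: "S \<in> sym_points \<longleftrightarrow> S $ 2 $ 1 = S $ 1 $ 2"
  by (auto simp: sym_points_def transpose_def vec_eq_iff forall_2)

lemma sym_points_eq_iff:
  assumes "S \<in> sym_points" "S' \<in> sym_points"
  shows "S = S' \<longleftrightarrow> S $ 1 $ 1 = S' $ 1 $ 1 \<and> S $ 1 $ 2 = S' $ 1 $ 2 \<and> S $ 2 $ 2 = S' $ 2 $ 2"
  using assms by (auto simp: sym_points_iff vec_eq_iff forall_2)

lemma sym_points_add: "S \<in> sym_points \<Longrightarrow> S' \<in> sym_points \<Longrightarrow> S + S' \<in> sym_points"
  by (simp add: sym_points_iff)

text \<open>
  \<open>ray u t\<close> is \<open>t\<close> times the square of the vector \<open>(s, 1)\<close> if \<open>u = Some s\<close>, and of \<open>(1, 0)\<close> if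
  \<open>u = None\<close>: directions are points of the projective line.
\<close>

definition ray :: "'a::field option \<Rightarrow> 'a \<Rightarrow> 'a ^ 2 ^ 2" where
  "ray u t = (case u of None \<Rightarrow> sym_mat t 0 0 | Some s \<Rightarrow> sym_mat (t * s\<^sup>2) (t * s) t)"

definition direction :: "'a::field ^ 2 ^ 2 \<Rightarrow> 'a option" where
  "direction S = (if S $ 2 $ 2 = 0 then None else Some (S $ 1 $ 2 / S $ 2 $ 2))"

lemma ray_in_sym_points: "ray u t \<in> sym_points"
  by (simp add: sym_points_iff ray_def split: option.split)

lemma ray_add: "ray u (s + t) = ray u s + ray u t"
  by (simp add: sym_points_eq_iff sym_points_add ray_in_sym_points)
     (simp add: ray_def algebra_simps split: option.split)

lemma ray_0 [simp]: "ray u 0 = 0"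
  using ray_add[of u 0 0] by simp

lemma ray_minus: "ray u (- t) = - ray u t"
  using ray_add[of u t "- t"] by (simp add: eq_neg_iff_add_eq_0 add.commute)

lemma ray_diff: "ray u (s - t) = ray u s - ray u t"
  using ray_add[of u s "- t"] by (simp add: ray_minus)

lemma ray_eq_0_iff [simp]: "ray u t = 0 \<longleftrightarrow> t = 0"
proof
  assume *: "ray u t = 0"
  have "ray u t $ 1 $ 1 = 0" "ray u t $ 2 $ 2 = 0"
    by (simp_all add: *)
  then show "t = 0"
    by (simp add: ray_def split: option.splits)
qed simp

lemma det_ray [simp]: "det (ray u t) = 0"
  by (simp add: ray_def det_2 power2_eq_square split: option.split)

lemma direction_ray: "t \<noteq> 0 \<Longrightarrow> direction (ray u t) = u"
  by (simp add: ray_def direction_def split: option.split)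

text \<open>A singular symmetric matrix with lower right entry 0 has off-diagonal entry 0; otherwise
  the other entries fix its upper left entry.\<close>

lemma ray_of_det_0:
  assumes "S \<in> sym_points" "det S = 0"
  shows "\<exists>u t. S = ray u t"
proof (cases "S $ 2 $ 2 = 0")
  case True
  then have "S = ray None (S $ 1 $ 1)"
    using assms by (simp add: sym_points_eq_iff ray_in_sym_points) (simp add: ray_def det_2 sym_points_iff)
  then show ?thesis by blast
next
  case False
  then have "S = ray (Some (S $ 1 $ 2 / S $ 2 $ 2)) (S $ 2 $ 2)"
    using assms by (simp add: sym_points_eq_iff ray_in_sym_points)
      (simp add: ray_def det_2 sym_points_iff power2_eq_square nonzero_eq_divide_eq eq_divide_eq)
  then show ?thesis by blast
qed

text \<open>Up to sign, the determinant is \<open>t * s\<close> times the squared determinant of the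
  two direction vectors. This is why every triangle lies on a line.\<close>

lemma direction_unique_of_adjacent_rays:
  assumes "det (ray u t - ray v s) = 0" "t \<noteq> 0" "s \<noteq> 0"
  shows "u = v"
proof -
  have "det (ray None t - ray (Some a) s) = - (t * s)" "det (ray (Some a) t - ray None s) = - (t * s)"
    "det (ray (Some a) t - ray (Some b) s) = - (t * s * (a - b)\<^sup>2)" for a b
    by (simp_all add: ray_def det_2 power2_eq_square algebra_simps)
  with assms show ?thesis
    by (cases u; cases v) auto
qed

lemma adjacent_obtain_ray:
  assumes "adjacent S S'" "S \<in> sym_points" "S' \<in> sym_points"
  obtains u t where "t \<noteq> 0" "S' = S + ray u t"
proof -
  have "S' - S \<in> sym_points" "det (S' - S) = 0" "S' \<noteq> S"
    using assms adjacent_sym[of S S'] by (auto simp: sym_points_iff adjacent_iff_det)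
  then obtain u t where "S' - S = ray u t"
    using ray_of_det_0 by blast
  then have "S' = S + ray u t" "t \<noteq> 0"
    using \<open>S' \<noteq> S\<close> by (auto simp: algebra_simps)
  then show ?thesis using that by blast
qed

lemma adjacent_add_ray_iff [simp]: "adjacent S (S + ray u t) \<longleftrightarrow> t \<noteq> 0"
  by (simp add: adjacent_iff_det)

lemma adjacent_same_ray_iff [simp]: "adjacent (S + ray u s) (S + ray u t) \<longleftrightarrow> s \<noteq> t"
  using adjacent_add_ray_iff[of "S + ray u s" u "t - s"] by (auto simp: ray_diff)

lemma direction_adjacent_eq:
  assumes "adjacent S P" "adjacent S Q" "adjacent P Q"
    and "S \<in> sym_points" "P \<in> sym_points" "Q \<in> sym_points"
  shows "direction (P - S) = direction (Q - S)"
proof -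
  obtain u t where P: "t \<noteq> 0" "P = S + ray u t"
    by (rule adjacent_obtain_ray[OF assms(1,4,5)])
  obtain v s where Q: "s \<noteq> 0" "Q = S + ray v s"
    by (rule adjacent_obtain_ray[OF assms(2,4,6)])
  have "det (ray v s - ray u t) = 0"
    using assms(3) by (simp add: P(2) Q(2) adjacent_iff_det)
  then have "v = u"
    using direction_unique_of_adjacent_rays P(1) Q(1) by blast
  then show ?thesis using P Q by (simp add: direction_ray)
qed

text \<open>With the preceding lemma, this lets directions at \<open>S\<close> label the lines
  through \<open>S\<close>.\<close>

lemma adjacent_of_direction_eq:
  assumes "adjacent S P" "adjacent S Q" "direction (P - S) = direction (Q - S)" "P \<noteq> Q"
    and "S \<in> sym_points" "P \<in> sym_points" "Q \<in> sym_points"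
  shows "adjacent P Q"
proof -
  obtain u t where P: "t \<noteq> 0" "P = S + ray u t"
    by (rule adjacent_obtain_ray[OF assms(1,5,6)])
  obtain v s where Q: "s \<noteq> 0" "Q = S + ray v s"
    by (rule adjacent_obtain_ray[OF assms(2,5,7)])
  show ?thesis using P Q assms(3,4) by (auto simp: direction_ray)
qed

section \<open>Lines as affine lines\<close>

text \<open>For maximality, two points suffice: adjacency to \<open>S\<close> puts an outside point
  on some ray from \<open>S\<close>, and adjacency to \<open>S + ray u 1\<close> forces that ray to
  have direction \<open>u\<close>.\<close>

lemma is_line_range_ray:
  assumes "S \<in> sym_points"
  shows "is_line (range (\<lambda>t. S + ray u t))"
proof -
  have False if P: "P \<in> sym_points" "P \<notin> range (\<lambda>t. S + ray u t)"
    and adj: "\<And>t. adjacent P (S + ray u t)" for P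
  proof -
    have "adjacent S P"
      using adj[of 0] adjacent_sym[of S P] by simp
    then obtain v r where v: "r \<noteq> 0" "P = S + ray v r"
      by (rule adjacent_obtain_ray[OF _ assms P(1)])
    have "det (ray u 1 - ray v r) = 0"
      using adj[of 1] by (simp add: v(2) adjacent_iff_det)
    then have "u = v"
      using direction_unique_of_adjacent_rays v(1) zero_neq_one by metis
    then show False using P(2) v by blast
  qed
  then show ?thesis
    using assms by (auto simp: is_line_def sym_points_add ray_in_sym_points)
qed

text \<open>No singleton is maximal, so a line has two points. They fix the direction, and
  maximality fills up the affine line.\<close>

lemma is_line_obtain_ray:
  assumes "is_line M"
  obtains S u where "S \<in> sym_points" "M = range (\<lambda>t. S + ray u t)"
proof -
  note M = assms[unfolded is_line_def]
  have "(0 :: 'a ^ 2 ^ 2) \<in> sym_points"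
    by (simp add: sym_points_iff)
  then obtain S where S: "S \<in> M" using M by blast
  then have Ss: "S \<in> sym_points" using M by blast
  have "\<exists>P\<in>M. P \<noteq> S"
  proof (rule ccontr)
    assume "\<not> ?thesis"
    with S have "M = {S}" by blast
    moreover have "S + ray None 1 \<in> sym_points - {S}"
      using sym_points_add[OF Ss ray_in_sym_points] by simp
    moreover have "adjacent (S + ray None 1) S"
      by (subst adjacent_sym) simp
    ultimately show False using M by blast
  qed
  then obtain P where P: "P \<in> M" "P \<noteq> S" by blast
  then have "adjacent S P" "P \<in> sym_points"
    using M S by auto
  then obtain u t where u: "t \<noteq> 0" "P = S + ray u t"
    by (rule adjacent_obtain_ray[OF _ Ss])
  let ?L = "range (\<lambda>t. S + ray u t)"
  have "Q \<in> ?L" if Q: "Q \<in> M" for Q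
  proof (cases "Q = S \<or> Q = P")
    case True
    then show ?thesis using u by (auto intro: range_eqI[of _ _ 0])
  next
    case False
    then have adj: "adjacent S Q" "adjacent P Q" and "Q \<in> sym_points"
      using M S P Q by auto
    then obtain v r where v: "r \<noteq> 0" "Q = S + ray v r"
      using adjacent_obtain_ray[OF adj(1) Ss] by metis
    have "det (ray v r - ray u t) = 0"
      using adj(2) by (simp add: u(2) v(2) adjacent_iff_det)
    then have "v = u"
      using direction_unique_of_adjacent_rays u(1) v(1) by blast
    then show ?thesis using v by blast
  qed
  then have "M \<subseteq> ?L" by blast
  moreover have "?L \<subseteq> M"
  proof
    fix R assume R: "R \<in> ?L"
    then have "R \<in> sym_points"
      using Ss by (auto simp: sym_points_add ray_in_sym_points)
    moreover have "adjacent R Q" if "Q \<in> M" "Q \<noteq> R" for Q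
      using that R \<open>M \<subseteq> ?L\<close> by auto
    ultimately show "R \<in> M" using M by blast
  qed
  ultimately show ?thesis using that Ss by blast
qed

section \<open>Characteristic 2: linear adjacency and regularity\<close>

lemma field_char_2:
  assumes "CARD('a::{field,finite}) = 2 ^ m"
  shows "(1 :: 'a) + 1 = 0"
proof -
  have "prime CHAR('a)"
    using finite_imp_CHAR_pos[where ?'a = 'a] prime_CHAR_semidom[where ?'a = 'a] by simp
  moreover have "CHAR('a) dvd 2 ^ m"
    using CHAR_dvd_CARD[where ?'a = 'a] assms by simp
  ultimately have "CHAR('a) = 2"
    by (metis prime_dvd_power primes_dvd_imp_eq two_is_prime_nat)
  then show ?thesis
    using of_nat_CHAR[where ?'a = 'a] by simp
qed
text \<open>Signs disappear, and so does the mixed product of off-diagonal entries, since it occurs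
  twice.\<close>

lemma adjacent_char_2_iff:
  fixes S S' :: "'a::field ^ 2 ^ 2"
  assumes "(1 :: 'a) + 1 = 0" "S \<in> sym_points" "S' \<in> sym_points"
  shows "adjacent S S' \<longleftrightarrow>
    S' \<noteq> S \<and> det S + det S' + S $ 1 $ 1 * S' $ 2 $ 2 + S' $ 1 $ 1 * S $ 2 $ 2 = 0"
proof -
  have "det (S' - S) = det S + det S' + S $ 1 $ 1 * S' $ 2 $ 2 + S' $ 1 $ 1 * S $ 2 $ 2 -
      (1 + 1) * (S $ 1 $ 1 * S' $ 2 $ 2 + S' $ 1 $ 1 * S $ 2 $ 2 - S $ 1 $ 2 * S' $ 1 $ 2)"
    using assms(2,3) by (simp add: det_2 sym_points_iff algebra_simps)
  then show ?thesis
    by (simp only: assms(1) adjacent_iff_det mult_zero_left diff_zero)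
qed

text \<open>Squaring is injective in characteristic 2, so the determinant and the diagonal recover
  the off-diagonal entry.\<close>

lemma sym_points_eqI_char_2:
  fixes S S' :: "'a::field ^ 2 ^ 2"
  assumes "(1 :: 'a) + 1 = 0" "S \<in> sym_points" "S' \<in> sym_points"
    and "S $ 1 $ 1 = S' $ 1 $ 1" "S $ 2 $ 2 = S' $ 2 $ 2" "det S = det S'"
  shows "S = S'"
proof -
  let ?b = "S $ 1 $ 2" and ?b' = "S' $ 1 $ 2"
  have "?b * ?b = ?b' * ?b'"
    using assms by (simp add: det_2 sym_points_iff)
  then have "(?b - ?b')\<^sup>2 = (1 + 1) * (?b' * ?b' - ?b * ?b')"
    by (simp add: power2_eq_square algebra_simps)
  then have "(?b - ?b')\<^sup>2 = 0"
    by (simp only: assms(1) mult_zero_left)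
  then have "?b = ?b'"
    by simp
  then show ?thesis
    using assms by (simp add: sym_points_eq_iff)
qed

text \<open>The linear adjacency equation gives the determinant of a neighbour of \<open>S\<close>
  from its diagonal.\<close>

lemma neighbor_eqI_char_2:
  fixes S P Q :: "'a::field ^ 2 ^ 2"
  assumes "(1 :: 'a) + 1 = 0" "S \<in> sym_points" "P \<in> sym_points" "Q \<in> sym_points"
    and "adjacent S P" "adjacent S Q" "P $ 1 $ 1 = Q $ 1 $ 1" "P $ 2 $ 2 = Q $ 2 $ 2"
  shows "P = Q"
proof -
  have "det S + det P + S $ 1 $ 1 * P $ 2 $ 2 + P $ 1 $ 1 * S $ 2 $ 2 = 0"
    "det S + det Q + S $ 1 $ 1 * Q $ 2 $ 2 + Q $ 1 $ 1 * S $ 2 $ 2 = 0"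
    using assms by (auto simp: adjacent_char_2_iff)
  then have "det S + det P + S $ 1 $ 1 * P $ 2 $ 2 + P $ 1 $ 1 * S $ 2 $ 2 =
    det S + det Q + S $ 1 $ 1 * Q $ 2 $ 2 + Q $ 1 $ 1 * S $ 2 $ 2"
    by simp
  then have "det P = det Q"
    using assms(7,8) by simp
  then show ?thesis
    using assms sym_points_eqI_char_2 by blast
qed

text \<open>
  Two independent affine equations in \<open>(a, c, d)\<close> define a line, so any further affine equation that
  holds at two of its points holds on all of it.
\<close>

lemma affine_equation_of_two_points:
  fixes a c d :: "nat \<Rightarrow> 'a::field"
  assumes y: "\<And>i. i < 3 \<Longrightarrow> dy + d i + ay * c i + a i * cy = 0"
    and y': "\<And>i. i < 3 \<Longrightarrow> dy' + d i + ay' * c i + a i * cy' = 0"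
    and w: "\<And>i. i < 2 \<Longrightarrow> dw + d i + aw * c i + a i * cw = 0"
    and ne: "ay \<noteq> ay' \<or> cy \<noteq> cy'" "a 0 \<noteq> a 1 \<or> c 0 \<noteq> c 1"
  shows "dw + d 2 + aw * c 2 + a 2 * cw = 0"
proof -
  define e where "e D A C i = D + d i + A * c i + a i * C" for D A C i
  define C where "C i = c i - c 0" for i
  define A where "A i = a i - a 0" for i
  have y0: "e dy ay cy i = 0" "e dy' ay' cy' i = 0" if "i < 3" for i
    using that y y' by (simp_all add: e_def)
  have w0: "e dw aw cw i = 0" if "i < 2" for i
    using that w by (simp add: e_def)
  \<comment> \<open>Taking differences in both the equation and the index eliminates
    \<open>d\<close>.\<close>
  have dep: "(ay - ay') * C i + A i * (cy - cy') = 0" if "i < 3" for i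
  proof -
    have "(ay - ay') * C i + A i * (cy - cy') =
        e dy ay cy i - e dy' ay' cy' i - e dy ay cy 0 + e dy' ay' cy' 0"
      by (simp add: e_def C_def A_def algebra_simps)
    then show ?thesis using y0 that by simp
  qed
  \<comment> \<open>By \<open>dep\<close>, a homogeneous 2x2 system has the nonzero solution
    \<open>(ay - ay', cy - cy')\<close>, so its determinant vanishes.\<close>
  have "(ay - ay') * (A 1 * C 2 - A 2 * C 1) =
      A 1 * ((ay - ay') * C 2 + A 2 * (cy - cy')) - A 2 * ((ay - ay') * C 1 + A 1 * (cy - cy'))"
    "(cy - cy') * (A 1 * C 2 - A 2 * C 1) =
      C 2 * ((ay - ay') * C 1 + A 1 * (cy - cy')) - C 1 * ((ay - ay') * C 2 + A 2 * (cy - cy'))"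
    by (simp_all add: algebra_simps)
  then have p: "A 1 * C 2 - A 2 * C 1 = 0"
    using dep ne(1) by auto
  define g where "g = (aw - ay) * C 2 + A 2 * (cw - cy)"
  have "e dw aw cw 2 = g + e dy ay cy 2 - e dy ay cy 0 + e dw aw cw 0"
    by (simp add: g_def e_def C_def A_def algebra_simps)
  then have g: "e dw aw cw 2 = g"
    using y0 w0 by simp
  have "(aw - ay) * C 1 + A 1 * (cw - cy) =
      e dw aw cw 1 - e dw aw cw 0 - e dy ay cy 1 + e dy ay cy 0"
    by (simp add: e_def C_def A_def algebra_simps)
  then have z: "(aw - ay) * C 1 + A 1 * (cw - cy) = 0"
    using y0 w0 by simp
  \<comment> \<open>The vectors \<open>(A 1, C 1)\<close> and \<open>(A 2, C 2)\<close> are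
    proportional and the first is nonzero, so the relation \<open>z\<close> at index 1 carries over
    to index 2.\<close>
  have "A 1 * g = (aw - ay) * (A 1 * C 2 - A 2 * C 1) + A 2 * ((aw - ay) * C 1 + A 1 * (cw - cy))"
    "C 1 * g = C 2 * ((aw - ay) * C 1 + A 1 * (cw - cy)) - (cw - cy) * (A 1 * C 2 - A 2 * C 1)"
    by (simp_all add: g_def algebra_simps)
  then have "A 1 * g = 0" "C 1 * g = 0"
    by (simp_all only: p z mult_zero_right add_0 diff_self)
  then have "g = 0"
    using ne(2) by (auto simp: A_def C_def)
  then show ?thesis
    using g by (simp add: e_def)
qed

text \<open>Regularity: a point adjacent to two common neighbours of \<open>y\<close> and
  \<open>y'\<close> is adjacent to the others. The case \<open>w = x\<^sub>3\<close> is excluded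
  because the linear equation holds there while adjacency is irreflexive.\<close>

lemma adjacent_regular:
  fixes y y' x\<^sub>1 x\<^sub>2 x\<^sub>3 w :: "'a::field ^ 2 ^ 2"
  assumes char: "(1 :: 'a) + 1 = 0"
    and pts: "{y, y', x\<^sub>1, x\<^sub>2, x\<^sub>3, w} \<subseteq> sym_points"
    and adj: "adjacent y x\<^sub>1" "adjacent y x\<^sub>2" "adjacent y x\<^sub>3"
      "adjacent y' x\<^sub>1" "adjacent y' x\<^sub>2" "adjacent y' x\<^sub>3"
    and w: "adjacent w x\<^sub>1" "adjacent w x\<^sub>2" "w \<noteq> x\<^sub>3"
    and ne: "y \<noteq> y'" "x\<^sub>1 \<noteq> x\<^sub>2"
  shows "adjacent w x\<^sub>3"
proof -
  define x where "x i = (if i = 0 then x\<^sub>1 else if i = 1 then x\<^sub>2 else x\<^sub>3)" for i :: nat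
  have eq: "det S + det P + S $ 1 $ 1 * P $ 2 $ 2 + P $ 1 $ 1 * S $ 2 $ 2 = 0"
    if "adjacent S P" "{S, P} \<subseteq> sym_points" for S P :: "'a ^ 2 ^ 2"
    using that char by (simp add: adjacent_char_2_iff)
  have "det w + det (x 2) + w $ 1 $ 1 * x 2 $ 2 $ 2 + x 2 $ 1 $ 1 * w $ 2 $ 2 = 0"
  proof (rule affine_equation_of_two_points)
    show "det y + det (x i) + y $ 1 $ 1 * x i $ 2 $ 2 + x i $ 1 $ 1 * y $ 2 $ 2 = 0" for i
      by (rule eq) (use adj pts in \<open>auto simp: x_def\<close>)
    show "det y' + det (x i) + y' $ 1 $ 1 * x i $ 2 $ 2 + x i $ 1 $ 1 * y' $ 2 $ 2 = 0" for i
      by (rule eq) (use adj pts in \<open>auto simp: x_def\<close>)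
    show "det w + det (x i) + w $ 1 $ 1 * x i $ 2 $ 2 + x i $ 1 $ 1 * w $ 2 $ 2 = 0" if "i < 2" for i
      by (rule eq) (use w pts that in \<open>auto simp: x_def\<close>)
    show "y $ 1 $ 1 \<noteq> y' $ 1 $ 1 \<or> y $ 2 $ 2 \<noteq> y' $ 2 $ 2"
      using neighbor_eqI_char_2[OF char, of x\<^sub>1 y y'] adj(1,4) pts ne(1) adjacent_sym[of x\<^sub>1] by auto
    show "x 0 $ 1 $ 1 \<noteq> x 1 $ 1 $ 1 \<or> x 0 $ 2 $ 2 \<noteq> x 1 $ 2 $ 2"
      using neighbor_eqI_char_2[OF char, of y x\<^sub>1 x\<^sub>2] adj(1,2) pts ne(2) by (auto simp: x_def)
  qed
  then show ?thesis
    using w(3) pts char by (simp add: adjacent_char_2_iff x_def)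
qed

text \<open>The diagonals of common neighbours lie on an affine line in the plane, and a diagonal
  determines the neighbour; hence one diagonal entry injects \<open>A\<close> into the
  field.\<close>

lemma card_common_neighbors_le:
  fixes x x' :: "'a::{field,finite} ^ 2 ^ 2"
  assumes char: "(1 :: 'a) + 1 = 0" and pts: "x \<in> sym_points" "x' \<in> sym_points" and "x \<noteq> x'"
    and A: "A \<subseteq> {w \<in> sym_points. adjacent x w \<and> adjacent x' w}"
  shows "card A \<le> CARD('a)"
proof (cases "A = {}")
  case False
  let ?\<alpha> = "x $ 1 $ 1 - x' $ 1 $ 1" and ?\<gamma> = "x $ 2 $ 2 - x' $ 2 $ 2"
  obtain w where "w \<in> A" using False by blast
  then have ne: "?\<alpha> \<noteq> 0 \<or> ?\<gamma> \<noteq> 0"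
    using neighbor_eqI_char_2[OF char, of w x x'] A pts \<open>x \<noteq> x'\<close> adjacent_sym[of w] by auto
  have line: "?\<alpha> * (P $ 2 $ 2 - Q $ 2 $ 2) + ?\<gamma> * (P $ 1 $ 1 - Q $ 1 $ 1) = 0"
    if "P \<in> A" "Q \<in> A" for P Q
  proof -
    let ?e = "\<lambda>S R. det S + det R + S $ 1 $ 1 * R $ 2 $ 2 + R $ 1 $ 1 * S $ 2 $ 2"
    have e: "?e S R = 0" if "S \<in> {x, x'}" "R \<in> {P, Q}" for S R
      using that \<open>P \<in> A\<close> \<open>Q \<in> A\<close> A pts char by (auto simp: adjacent_char_2_iff)
    have "?\<alpha> * (P $ 2 $ 2 - Q $ 2 $ 2) + ?\<gamma> * (P $ 1 $ 1 - Q $ 1 $ 1) =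
        ?e x P - ?e x' P - ?e x Q + ?e x' Q"
      by (simp add: algebra_simps)
    then show ?thesis
      by (simp only: e insertI1 insertI2 diff_self add_0)
  qed
  have inj: "P = Q" if "P \<in> A" "Q \<in> A" "P $ 1 $ 1 = Q $ 1 $ 1" "P $ 2 $ 2 = Q $ 2 $ 2" for P Q
    using neighbor_eqI_char_2[OF char, of x P Q] that A pts by auto
  have "\<exists>f :: 'a ^ 2 ^ 2 \<Rightarrow> 'a. inj_on f A"
  proof (cases "?\<alpha> = 0")
    case True
    have "inj_on (\<lambda>S. S $ 2 $ 2) A"
    proof (rule inj_onI)
      fix P Q assume PQ: "P \<in> A" "Q \<in> A" "P $ 2 $ 2 = Q $ 2 $ 2"
      then have "P $ 1 $ 1 = Q $ 1 $ 1"
        using line[OF PQ(1,2)] True ne by simp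
      then show "P = Q" using inj PQ by blast
    qed
    then show ?thesis by blast
  next
    case False
    have "inj_on (\<lambda>S. S $ 1 $ 1) A"
    proof (rule inj_onI)
      fix P Q assume PQ: "P \<in> A" "Q \<in> A" "P $ 1 $ 1 = Q $ 1 $ 1"
      then have "P $ 2 $ 2 = Q $ 2 $ 2"
        using line[OF PQ(1,2)] False by simp
      then show "P = Q" using inj PQ by blast
    qed
    then show ?thesis by blast
  qed
  then obtain f :: "'a ^ 2 ^ 2 \<Rightarrow> 'a" where "inj_on f A" by blast
  then show ?thesis
    using card_inj_on_le[of f A UNIV] by simp
qed simp

section \<open>Lower bound for stopping sets\<close>

text \<open>The geometric form of a stopping set: no line is tangent to \<open>T\<close>.
  Quantifying over points and directions yields the second point directly.\<close>

definition tangent_free :: "('a::field ^ 2 ^ 2) set \<Rightarrow> bool" where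
  "tangent_free T \<longleftrightarrow> T \<subseteq> sym_points \<and> (\<forall>S\<in>T. \<forall>u. \<exists>t. t \<noteq> 0 \<and> S + ray u t \<in> T)"

text \<open>\<open>T\<close> has a neighbour of \<open>S\<close> in each of the q + 1 directions, so
  \<open>A\<close> maps onto all directions.\<close>

lemma tangent_free_card_ge:
  fixes T :: "('a::{field,finite} ^ 2 ^ 2) set"
  assumes "tangent_free T" "S \<in> T"
    and rep: "\<And>w. w \<in> T \<Longrightarrow> adjacent S w \<Longrightarrow> \<exists>w'\<in>A. direction (w' - S) = direction (w - S)"
  shows "CARD('a) + 1 \<le> card A"
proof -
  have "u \<in> (\<lambda>w. direction (w - S)) ` A" for u
  proof -
    obtain t where t: "t \<noteq> 0" "S + ray u t \<in> T"
      using assms(1,2) unfolding tangent_free_def by blast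
    obtain w' where "w' \<in> A" "direction (w' - S) = direction (S + ray u t - S)"
      using rep[OF t(2)] t(1) by auto
    then show ?thesis using t(1) by (auto simp: direction_ray image_iff)
  qed
  then have "(\<lambda>w. direction (w - S)) ` A = UNIV" by blast
  then have "CARD('a option) \<le> card A"
    using card_image_le[of A "\<lambda>w. direction (w - S)"] by simp
  then show ?thesis
    by (simp add: card_UNIV_option)
qed

text \<open>At each \<open>b\<close>, the set \<open>A\<close> covers at most \<open>card A\<close>
  directions, and the rest need points outside \<open>A\<close>. By \<open>maximal\<close>,
  different \<open>b\<close> get disjoint sets of such points.\<close>

lemma card_neighbors_outside_ge:
  fixes T :: "('a::{field,finite} ^ 2 ^ 2) set"
  assumes T: "tangent_free T" and AB: "A \<subseteq> T" "B \<subseteq> T"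
    and complete: "\<And>a b. a \<in> A \<Longrightarrow> b \<in> B \<Longrightarrow> adjacent b a"
    and "A \<noteq> {}"
    and maximal: "\<And>b b' w. b \<in> B \<Longrightarrow> b' \<in> B \<Longrightarrow> b \<noteq> b' \<Longrightarrow> w \<in> T - B \<Longrightarrow>
      adjacent b w \<Longrightarrow> adjacent b' w \<Longrightarrow> w \<in> A"
  shows "card B * (CARD('a) + 1 - card A) \<le>
    card {w \<in> T. w \<notin> A \<and> (\<exists>b\<in>B. adjacent b w) \<and> (\<forall>a\<in>A. \<not> adjacent a w)}"
proof -
  have sym: "T \<subseteq> sym_points" using T by (simp add: tangent_free_def)
  define R where "R b = {w \<in> T. w \<notin> A \<and> adjacent b w \<and> (\<forall>a\<in>A. \<not> adjacent a w)}" for b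
  have disj: "R b \<inter> R b' = {}" if "b \<in> B" "b' \<in> B" "b \<noteq> b'" for b b'
  proof (rule ccontr)
    assume "R b \<inter> R b' \<noteq> {}"
    then obtain w where w: "w \<in> T" "w \<notin> A" "adjacent b w" "adjacent b' w" "\<forall>a\<in>A. \<not> adjacent a w"
      by (auto simp: R_def)
    then have "w \<notin> B"
      using complete \<open>A \<noteq> {}\<close> adjacent_sym[of w] by blast
    then show False
      using maximal[OF that] w by blast
  qed
  have "CARD('a) + 1 - card A \<le> card (R b)" if b: "b \<in> B" for b
  proof -
    have "CARD('a) + 1 \<le> card (A \<union> R b)"
    proof (rule tangent_free_card_ge[OF T])
      fix w assume w: "w \<in> T" "adjacent b w"
      show "\<exists>w'\<in>A \<union> R b. direction (w' - b) = direction (w - b)"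
      proof (cases "\<exists>a\<in>A. adjacent a w")
        \<comment> \<open>Here \<open>b\<close>, \<open>a\<close>, \<open>w\<close> form a triangle,
          so \<open>a\<close> already represents the direction of \<open>w\<close>.\<close>
        case True
        then obtain a where a: "a \<in> A" "adjacent a w" by blast
        then have "direction (a - b) = direction (w - b)"
          using direction_adjacent_eq[of b a w] complete[of a b] b w AB sym by blast
        then show ?thesis using a by blast
      next
        case False
        then show ?thesis using w by (auto simp: R_def)
      qed
    qed (use b AB in blast)
    then show ?thesis
      using card_Un_le[of A "R b"] by linarith
  qed
  then have "card B * (CARD('a) + 1 - card A) \<le> (\<Sum>b\<in>B. card (R b))"
    using sum_bounded_below[of B "CARD('a) + 1 - card A" "\<lambda>b. card (R b)"] by simp
  also have "\<dots> = card (\<Union>b\<in>B. R b)"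
    by (rule card_UN_disjoint[symmetric]) (use disj in auto)
  also have "(\<Union>b\<in>B. R b) = {w \<in> T. w \<notin> A \<and> (\<exists>b\<in>B. adjacent b w) \<and> (\<forall>a\<in>A. \<not> adjacent a w)}"
    by (auto simp: R_def)
  finally show ?thesis .
qed

lemma tangent_free_quadrangle_card_ge:
  fixes T :: "('a::{field,finite} ^ 2 ^ 2) set"
  assumes char: "(1 :: 'a) + 1 = 0" and T: "tangent_free T"
    and pts: "x \<in> T" "x' \<in> T" "y \<in> T" "y' \<in> T"
    and adj: "adjacent x y" "adjacent x y'" "adjacent x' y" "adjacent x' y'"
    and ne: "x \<noteq> x'" "y \<noteq> y'" "\<not> adjacent x x'"
  shows "4 * CARD('a) \<le> card T"
proof -
  define A where "A = {w \<in> T. adjacent x w \<and> adjacent x' w}"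
  define B where "B = {w \<in> T. adjacent y w \<and> adjacent y' w}"
  have sym: "z \<in> sym_points" if "z \<in> T" for z
    using T that by (auto simp: tangent_free_def)
  note syms = pts[THEN sym]
  have adj': "adjacent y x" "adjacent y' x" "adjacent y x'" "adjacent y' x'"
    using adj by (simp_all only: adjacent_sym[of y] adjacent_sym[of y'])
  have yA: "y \<in> A" "y' \<in> A" and xB: "x \<in> B" "x' \<in> B"
    using pts adj adj' by (simp_all add: A_def B_def)
  \<comment> \<open>A common point would see \<open>x\<close>, \<open>y\<close> and
    \<open>x'\<close> in one direction, making \<open>x\<close> and \<open>x'\<close>
    adjacent.\<close>
  have AB: "a \<noteq> b" if "a \<in> A" "b \<in> B" for a b
  proof
    assume "a = b"
    then have a: "a \<in> T" "adjacent a x" "adjacent a x'" "adjacent a y"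
      using that adjacent_sym by (auto simp: A_def B_def)
    have "direction (x - a) = direction (y - a)" "direction (x' - a) = direction (y - a)"
      using direction_adjacent_eq[of a x y] direction_adjacent_eq[of a x' y] a adj syms sym by simp_all
    then have "adjacent x x'"
      using adjacent_of_direction_eq[of a x x'] a ne(1) syms sym by simp
    then show False using ne(3) by blast
  qed
  \<comment> \<open>Regularity for the pair \<open>x\<close>, \<open>x'\<close> with common
    neighbours \<open>y\<close>, \<open>y'\<close>, \<open>a\<close>: the point \<open>b\<close> is
    adjacent to the first two.\<close>
  have complete: "adjacent b a" if a: "a \<in> A" and b: "b \<in> B" for a b
  proof (rule adjacent_regular[OF char])
    show "{x, x', y, y', a, b} \<subseteq> sym_points"
      using syms sym a b by (simp add: A_def B_def)
    show "adjacent b y" "adjacent b y'"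
      using b by (simp_all add: B_def adjacent_sym[of b])
    show "b \<noteq> a" using AB a b by blast
  qed (use a adj ne in \<open>simp_all add: A_def\<close>)
  have complete': "adjacent a b" if "a \<in> A" "b \<in> B" for a b
    using complete that adjacent_sym by blast
  \<comment> \<open>By regularity for \<open>y\<close>, \<open>y'\<close>, such a \<open>w\<close>
    is adjacent to all of \<open>B\<close>, in particular to \<open>x\<close> and
    \<open>x'\<close>.\<close>
  have maxA: "w \<in> A" if b: "b \<in> B" "b' \<in> B" "b \<noteq> b'" and w: "w \<in> T - B" "adjacent b w" "adjacent b' w" for b b' w
  proof -
    have "adjacent w z" if "z \<in> B" for z
    proof (rule adjacent_regular[OF char])
      show "{y, y', b, b', z, w} \<subseteq> sym_points"
        using syms sym b w that by (simp add: B_def)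
      show "adjacent w b" "adjacent w b'"
        using w by (simp_all only: adjacent_sym[of w])
      show "w \<noteq> z" using w that by blast
    qed (use b that ne in \<open>simp_all add: B_def\<close>)
    then show ?thesis
      using xB w adjacent_sym by (auto simp: A_def)
  qed
  have maxB: "w \<in> B" if a: "a \<in> A" "a' \<in> A" "a \<noteq> a'" and w: "w \<in> T - A" "adjacent a w" "adjacent a' w" for a a' w
  proof -
    have "adjacent w z" if "z \<in> A" for z
    proof (rule adjacent_regular[OF char])
      show "{x, x', a, a', z, w} \<subseteq> sym_points"
        using syms sym a w that by (simp add: A_def)
      show "adjacent w a" "adjacent w a'"
        using w by (simp_all only: adjacent_sym[of w])
      show "w \<noteq> z" using w that by blast
    qed (use a that ne in \<open>simp_all add: A_def\<close>)
    then show ?thesis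
      using yA w adjacent_sym by (auto simp: B_def)
  qed
  define N where "N = CARD('a)"
  define X where "X = {w \<in> T. w \<notin> A \<and> (\<exists>b\<in>B. adjacent b w) \<and> (\<forall>a\<in>A. \<not> adjacent a w)}"
  define Y where "Y = {w \<in> T. w \<notin> B \<and> (\<exists>a\<in>A. adjacent a w) \<and> (\<forall>b\<in>B. \<not> adjacent b w)}"
  have subT: "A \<subseteq> T" "B \<subseteq> T" "X \<subseteq> T" "Y \<subseteq> T"
    by (auto simp: A_def B_def X_def Y_def)
  have X: "card B * (N + 1 - card A) \<le> card X"
    unfolding N_def X_def
  proof (rule card_neighbors_outside_ge[OF T subT(1,2) complete])
    show "A \<noteq> {}" using yA by blast
  qed (assumption | erule (5) maxA)+
  have Y: "card A * (N + 1 - card B) \<le> card Y"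
    unfolding N_def Y_def
  proof (rule card_neighbors_outside_ge[OF T subT(2,1) complete'])
    show "B \<noteq> {}" using xB by blast
  qed (assumption | erule (5) maxB)+
  have disj: "A \<inter> B = {}" "(A \<union> B) \<inter> X = {}" "(A \<union> B \<union> X) \<inter> Y = {}"
    using AB complete complete' yA xB by (auto simp: X_def Y_def)
  have "card A + card B + card X + card Y = card (A \<union> B \<union> X \<union> Y)"
    using disj by (simp add: card_Un_disjoint)
  also have "\<dots> \<le> card T"
    using subT by (intro card_mono) auto
  finally have total: "card A + card B + card X + card Y \<le> card T" .
  have le: "card A \<le> N" "card B \<le> N"
    using card_common_neighbors_le[OF char syms(1,2) ne(1), of A]
      card_common_neighbors_le[OF char syms(3,4) ne(2), of B] sym
    by (auto simp: N_def A_def B_def)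
  have ge: "2 \<le> card A" "2 \<le> card B"
    using card_mono[of A "{y, y'}"] card_mono[of B "{x, x'}"] yA xB ne by auto
  \<comment> \<open>The slacks \<open>i\<close>, \<open>j\<close> and the excesses \<open>a\<close>,
    \<open>b\<close> below replace truncated subtraction on naturals.\<close>
  obtain i j where ij: "N = card A + i" "N = card B + j"
    using le by (metis le_iff_add)
  then have diff: "N + 1 - card A = i + 1" "N + 1 - card B = j + 1"
    by linarith+
  obtain a b where ab: "card A = a + 2" "card B = b + 2"
    using ge by (metis add.commute le_iff_add)
  \<comment> \<open>the difference of the two sides is \<open>a j + b i\<close>\<close>
  have "4 * N \<le> card A + card B + card B * (i + 1) + card A * (j + 1)"
    using ij by (simp add: ab algebra_simps)
  also have "\<dots> \<le> card A + card B + card X + card Y"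
    using X Y diff by simp
  finally show ?thesis
    using total by (simp add: N_def)
qed

lemma tangent_free_card_ge_4:
  fixes T :: "('a::{field,finite} ^ 2 ^ 2) set"
  assumes char: "(1 :: 'a) + 1 = 0" and T: "tangent_free T" and "T \<noteq> {}"
  shows "4 * CARD('a) \<le> card T"
proof (rule ccontr)
  assume small: "\<not> ?thesis"
  have sym: "z \<in> sym_points" if "z \<in> T" for z
    using T that by (auto simp: tangent_free_def)
  obtain x where x: "x \<in> T" using \<open>T \<noteq> {}\<close> by blast
  have "\<forall>u. \<exists>t. t \<noteq> 0 \<and> x + ray u t \<in> T"
    using T x unfolding tangent_free_def by blast
  then obtain r where r: "\<And>u. r u \<noteq> 0" "\<And>u. x + ray u (r u) \<in> T" by metis
  define y where "y u = x + ray u (r u)" for u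
  \<comment> \<open>The neighbours of \<open>y u\<close> in \<open>T\<close> off the line back to
    \<open>x\<close>, which has direction \<open>u\<close> from both ends.\<close>
  define Z where "Z u = {w \<in> T. adjacent (y u) w \<and> direction (w - y u) \<noteq> u}" for u
  have yT: "y u \<in> T" and xy: "adjacent x (y u)" and dir_y: "direction (y u - x) = u"
    and dir_x: "direction (x - y u) = u" for u
    using r[of u] by (simp_all add: y_def direction_ray flip: ray_minus)
  have yx: "adjacent (y u) x" for u
    using xy adjacent_sym by blast
  have y_nonadj: "\<not> adjacent (y u) (y v)" for u v
  proof
    assume adj: "adjacent (y u) (y v)"
    then have "u = v"
      using direction_adjacent_eq[of x "y u" "y v"] xy yT x sym dir_y by metis
    then show False using adj by (simp add: adjacent_iff_det)
  qed
  have inj: "inj y" using dir_y by (metis injI)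
  have Z: "CARD('a) \<le> card (Z u)" for u
  proof -
    have "CARD('a) + 1 \<le> card (insert x (Z u))"
    proof (rule tangent_free_card_ge[OF T yT])
      fix w assume "w \<in> T" "adjacent (y u) w"
      then show "\<exists>w'\<in>insert x (Z u). direction (w' - y u) = direction (w - y u)"
        using dir_x by (cases "direction (w - y u) = u") (auto simp: Z_def)
    qed
    also have "\<dots> \<le> card (Z u) + 1"
      by (simp add: card_insert_if)
    finally show ?thesis by simp
  qed
  \<comment> \<open>A common point would close a quadrangle with \<open>x\<close>,
    \<open>y u\<close>, \<open>y v\<close>, which \<open>small\<close> rules out.\<close>
  have disj: "Z u \<inter> Z v = {}" if "u \<noteq> v" for u v
  proof (rule ccontr)
    assume "Z u \<inter> Z v \<noteq> {}"
    then obtain w where w: "w \<in> T" "adjacent (y u) w" "direction (w - y u) \<noteq> u" "adjacent (y v) w"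
      by (auto simp: Z_def)
    have "x \<noteq> w" using w(3) dir_x by blast
    moreover have "\<not> adjacent x w"
      using direction_adjacent_eq[OF yx w(2)] yT x w sym dir_x by metis
    moreover have "y u \<noteq> y v" using that inj by (auto dest: injD)
    moreover have "adjacent w (y u)" "adjacent w (y v)"
      using w adjacent_sym by blast+
    ultimately show False
      using tangent_free_quadrangle_card_ge[OF char T x w(1) yT yT xy xy] small by blast
  qed
  have "CARD('a option) * CARD('a) \<le> (\<Sum>u\<in>UNIV. card (Z u))"
    using sum_bounded_below[of UNIV "CARD('a)" "\<lambda>u. card (Z u)"] Z by simp
  also have "\<dots> = card (\<Union>u. Z u)"
    by (rule card_UN_disjoint[symmetric]) (use disj in auto)
  finally have "CARD('a option) * CARD('a) + card (range y) \<le> card (\<Union>u. Z u) + card (range y)"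
    by simp
  also have "\<dots> = card ((\<Union>u. Z u) \<union> range y)"
    by (rule card_Un_disjoint[symmetric]) (use y_nonadj in \<open>auto simp: Z_def\<close>)
  also have "\<dots> \<le> card T"
    using yT by (intro card_mono) (auto simp: Z_def)
  finally have "(CARD('a) + 1) * (CARD('a) + 1) \<le> card T"
    by (simp add: card_UNIV_option card_image[OF inj] algebra_simps)
  \<comment> \<open>The difference of the two sides is \<open>(n - 1)\<^sup>2\<close>, taken over
    the integers.\<close>
  moreover have "4 * n \<le> (n + 1) * (n + 1)" for n :: nat
  proof -
    have "int (4 * n) \<le> int ((n + 1) * (n + 1))"
      using zero_le_square[of "int n - 1"] by (simp add: algebra_simps)
    then show ?thesis by (simp only: of_nat_le_iff)
  qed
  ultimately show False using small by (meson le_trans)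
qed

section \<open>Parity, codewords and stopping sets\<close>

text \<open>The orbits \<open>{x, f x}\<close> partition \<open>A\<close> into pairs.\<close>

lemma even_card_fixpoint_free_involution:
  assumes "finite A" "\<And>x. x \<in> A \<Longrightarrow> f x \<in> A" "\<And>x. x \<in> A \<Longrightarrow> f (f x) = x" "\<And>x. x \<in> A \<Longrightarrow> f x \<noteq> x"
  shows "even (card A)"
proof -
  have "\<Union>((\<lambda>x. {x, f x}) ` A) = A"
    using assms(2) by auto
  moreover have "even (card (\<Union>((\<lambda>x. {x, f x}) ` A)))"
  proof (rule dvd_partition)
    show "\<forall>c\<in>(\<lambda>x. {x, f x}) ` A. even (card c)"
      using assms(4) by (auto simp: card_insert_if eq_commute)
    show "\<forall>c1\<in>(\<lambda>x. {x, f x}) ` A. \<forall>c2\<in>(\<lambda>x. {x, f x}) ` A. c1 \<noteq> c2 \<longrightarrow> c1 \<inter> c2 = {}"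
    proof (intro ballI impI, elim imageE)
      fix c1 c2 x y assume "c1 = {x, f x}" "c2 = {y, f y}" "x \<in> A" "y \<in> A" "c1 \<noteq> c2"
      then show "c1 \<inter> c2 = {}"
        using assms(3)[of x] assms(3)[of y] by (cases "x = y"; cases "x = f y"; cases "f x = y") auto
    qed
  qed (use assms(1,2) in auto)
  ultimately show ?thesis by simp
qed

lemma sum_bit_eq_0_iff:
  fixes f :: "'n \<Rightarrow> bit"
  assumes "finite N"
  shows "(\<Sum>j\<in>N. f j) = 0 \<longleftrightarrow> even (card {j \<in> N. f j = 1})"
proof -
  have "(\<Sum>j\<in>N. f j) = (\<Sum>j\<in>N. if f j = 1 then 1 else 0)"
    by (rule sum.cong) simp_all
  also have "\<dots> = of_nat (card {j \<in> N. f j = 1})"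
    using assms by (simp flip: sum.inter_filter)
  finally show ?thesis
    by (simp only: Z2.bit_eq_iff even_of_nat even_zero simp_thms)
qed

text \<open>The sum of two codewords is a codeword, so every row meets its support in an even number
  of positions, never in one. Lower bounds for stopping sets thus apply to the minimum
  distance.\<close>

lemma stopping_set_difference:
  assumes "finite N" "c \<in> parity_check_code H R N" "d \<in> parity_check_code H R N"
  shows "stopping_set H R N {j \<in> N. c j \<noteq> d j}"
  unfolding stopping_set_def
proof (intro conjI ballI notI)
  fix r assume r: "r \<in> R" and one: "card {j \<in> {j \<in> N. c j \<noteq> d j}. H r j = 1} = 1"
  have eq: "{j \<in> {j \<in> N. c j \<noteq> d j}. H r j = 1} = {j \<in> N. H r j * c j + H r j * d j = 1}"
  proof -
    have "c j \<noteq> d j \<and> H r j = 1 \<longleftrightarrow> H r j * c j + H r j * d j = 1" for j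
      by (cases "H r j"; cases "c j"; cases "d j") simp_all
    then show ?thesis by auto
  qed
  have "(\<Sum>j\<in>N. H r j * c j) = 0" "(\<Sum>j\<in>N. H r j * d j) = 0"
    using assms r unfolding parity_check_code_def by blast+
  then have "(\<Sum>j\<in>N. H r j * c j + H r j * d j) = 0"
    by (simp only: sum.distrib add_0)
  then show False
    using one unfolding eq sum_bit_eq_0_iff[OF assms(1)] by (simp only: odd_one)
qed auto

lemma indicator_in_parity_check_code:
  assumes "finite N" "T \<subseteq> N" "\<And>r. r \<in> R \<Longrightarrow> even (card {j \<in> T. H r j = 1})"
  shows "restrict (\<lambda>j. of_bool (j \<in> T)) N \<in> parity_check_code H R N"
proof -
  have "(\<Sum>j\<in>N. H r j * restrict (\<lambda>j. of_bool (j \<in> T)) N j) = 0" if "r \<in> R" for r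
  proof -
    have "{j \<in> N. H r j * restrict (\<lambda>j. of_bool (j \<in> T)) N j = 1} = {j \<in> T. H r j = 1}"
      using assms(2) by auto
    then show ?thesis
      using assms(3)[OF that] by (simp only: sum_bit_eq_0_iff[OF assms(1)])
  qed
  moreover have "restrict (\<lambda>j. of_bool (j \<in> T)) N \<in> N \<rightarrow>\<^sub>E (UNIV :: bit set)"
    by simp
  ultimately show ?thesis
    unfolding parity_check_code_def by blast
qed

lemma H2_eq_1: "{j \<in> T. H2 M j = 1} = T \<inter> M"
  by (auto simp: H2_def)

text \<open>The affine line through \<open>S\<close> in direction \<open>u\<close> is a row of the
  matrix, so it cannot meet \<open>T\<close> in \<open>S\<close> alone.\<close>

lemma tangent_free_of_stopping_set:
  fixes T :: "('a::{field,finite} ^ 2 ^ 2) set"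
  assumes "stopping_set H2 {M. is_line M} sym_points T"
  shows "tangent_free T"
  unfolding tangent_free_def
proof (intro conjI ballI allI)
  show "T \<subseteq> sym_points"
    using assms by (simp add: stopping_set_def)
next
  fix S u assume S: "S \<in> T"
  let ?L = "range (\<lambda>t. S + ray u t)"
  have "is_line ?L"
    using is_line_range_ray S assms by (auto simp: stopping_set_def)
  then have "card (T \<inter> ?L) \<noteq> 1"
    using assms by (simp add: stopping_set_def H2_eq_1)
  moreover have "S \<in> T \<inter> ?L"
    using S range_eqI[of S "\<lambda>t. S + ray u t" 0] by simp
  moreover have "T \<inter> ?L \<noteq> {S}"
    using calculation(1) by fastforce
  ultimately obtain P where "P \<in> T \<inter> ?L" "P \<noteq> S"
    by blast
  then show "\<exists>t. t \<noteq> 0 \<and> S + ray u t \<in> T" by auto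
qed

section \<open>A codeword of weight 4q\<close>

text \<open>
  The subgroup has to contain some multiple of each square \<open>(s\<^sup>2, s; s, 1)\<close> and of \<open>(1, 0; 0, 0)\<close>;
  the two conditions hold for the matrices \<open>ray u 1\<close>, and are additive in characteristic 2.
\<close>

definition small_word_support :: "('a::field ^ 2 ^ 2) set" where
  "small_word_support = {S \<in> sym_points. S $ 2 $ 2 \<in> {0, 1} \<and> (S $ 1 $ 2)\<^sup>2 + S $ 1 $ 1 \<in> {0, 1}}"

text \<open>The off-diagonal entry is free, and there are two choices each for the lower right entry
  and for the value \<open>e\<close> of the second expression.\<close>

lemma card_small_word_support: "card (small_word_support :: ('a::{field,finite} ^ 2 ^ 2) set) = 4 * CARD('a)"
proof -
  let ?D = "{0, 1 :: 'a} \<times> (UNIV :: 'a set) \<times> {0, 1 :: 'a}"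
  let ?f = "\<lambda>(e :: 'a, b :: 'a, c :: 'a). sym_mat (e - b\<^sup>2) b c"
  have img: "small_word_support = ?f ` ?D"
  proof (intro equalityI subsetI)
    fix S :: "'a ^ 2 ^ 2" assume S: "S \<in> small_word_support"
    then have "S $ 2 $ 1 = S $ 1 $ 2"
      by (simp add: small_word_support_def sym_points_iff)
    then have "S = ?f ((S $ 1 $ 2)\<^sup>2 + S $ 1 $ 1, S $ 1 $ 2, S $ 2 $ 2)"
      by (simp add: vec_eq_iff forall_2)
    moreover have "((S $ 1 $ 2)\<^sup>2 + S $ 1 $ 1, S $ 1 $ 2, S $ 2 $ 2) \<in> ?D"
      using S by (simp add: small_word_support_def)
    ultimately show "S \<in> ?f ` ?D" by (rule image_eqI)
  next
    fix S assume "S \<in> ?f ` ?D"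
    then obtain p where p: "p \<in> ?D" "S = ?f p"
      by (rule imageE) auto
    obtain e b c where ebc: "p = (e, b, c)"
      by (rule prod_cases3)
    have S: "S = sym_mat (e - b\<^sup>2) b c" "e \<in> {0, 1}" "c \<in> {0, 1}"
      using p unfolding ebc by simp_all
    have "b\<^sup>2 + (e - b\<^sup>2) = e"
      by simp
    then show "S \<in> small_word_support"
      using S(2,3) by (simp only: small_word_support_def mem_Collect_eq S(1) sym_points_iff sym_mat_nth simp_thms)
  qed
  have inj: "inj_on ?f ?D"
    by (rule inj_onI) (auto simp: sym_mat_eq_iff)
  have "card (small_word_support :: ('a ^ 2 ^ 2) set) = card ?D"
    unfolding img by (rule card_image[OF inj])
  then show ?thesis
    by (simp add: card_cartesian_product)
qed

text \<open>The translation changes exactly one of the two constrained quantities, by 1: the second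
  for \<open>None\<close>, the first for \<open>Some s\<close>.\<close>

lemma small_word_support_add_ray:
  fixes S :: "'a::field ^ 2 ^ 2"
  assumes char: "(1 :: 'a) + 1 = 0" and S: "S \<in> small_word_support"
  shows "S + ray u 1 \<in> small_word_support"
proof -
  have bit_add_1: "e + 1 \<in> {0, 1}" if "e \<in> {0, 1}" for e :: 'a
    using that char by auto
  have "(S + ray u 1) $ 2 $ 2 \<in> {0, 1} \<and> ((S + ray u 1) $ 1 $ 2)\<^sup>2 + (S + ray u 1) $ 1 $ 1 \<in> {0, 1}"
  proof (cases u)
    case None
    have "(S $ 1 $ 2)\<^sup>2 + S $ 1 $ 1 + 1 \<in> {0, 1}"
      using S by (intro bit_add_1) (simp add: small_word_support_def)
    then show ?thesis
      using S None by (simp add: small_word_support_def ray_def add.assoc)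
  next
    case (Some s)
    have "(S $ 1 $ 2 + s)\<^sup>2 + (S $ 1 $ 1 + s\<^sup>2) =
        (S $ 1 $ 2)\<^sup>2 + S $ 1 $ 1 + (1 + 1) * (S $ 1 $ 2 * s + s\<^sup>2)"
      by (simp add: power2_eq_square algebra_simps)
    also have "\<dots> = (S $ 1 $ 2)\<^sup>2 + S $ 1 $ 1"
      by (simp only: char mult_zero_left add_0_right)
    finally have "(S $ 1 $ 2 + s)\<^sup>2 + (S $ 1 $ 1 + s\<^sup>2) \<in> {0, 1}"
      using S unfolding small_word_support_def by (simp only: mem_Collect_eq)
    moreover have "S $ 2 $ 2 + 1 \<in> {0, 1}"
      using S by (intro bit_add_1) (simp add: small_word_support_def)
    ultimately show ?thesis
      using Some by (simp add: ray_def)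
  qed
  then show ?thesis
    using S by (simp add: small_word_support_def sym_points_add ray_in_sym_points)
qed

text \<open>Translation by \<open>ray u 1\<close> along a line of direction \<open>u\<close> is an
  involution in characteristic 2 that pairs up the intersection.\<close>

lemma even_card_small_word_support_Int_line:
  fixes M :: "('a::{field,finite} ^ 2 ^ 2) set"
  assumes char: "(1 :: 'a) + 1 = 0" and "is_line M"
  shows "even (card (small_word_support \<inter> M))"
proof -
  obtain S u where M: "M = range (\<lambda>t. S + ray u t)"
    using is_line_obtain_ray[OF assms(2)] by metis
  show ?thesis
  proof (rule even_card_fixpoint_free_involution[where f = "\<lambda>P. P + ray u 1"])
    fix P assume P: "P \<in> small_word_support \<inter> M"
    then obtain t where "P = S + ray u t" using M by blast
    then have "P + ray u 1 = S + ray u (t + 1)"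
      by (simp add: ray_add add.assoc)
    then have "P + ray u 1 \<in> M"
      unfolding M by blast
    then show "P + ray u 1 \<in> small_word_support \<inter> M"
      using P small_word_support_add_ray[OF char] by blast
    show "P + ray u 1 + ray u 1 = P"
      unfolding add.assoc ray_add[symmetric] char by simp
    show "P + ray u 1 \<noteq> P" by simp
  qed simp
qed

section \<open>Both distances\<close>

theorem theorem5:
  fixes q m :: nat
  assumes "CARD('a::{field,finite}) = q"
    and "q = 2 ^ m" and "m \<ge> 1"
  shows "min_distance sym_points (C2 :: ('a ^ 2 ^ 2 \<Rightarrow> bit) set) = 4 * q \<and>
         stopping_distance H2 {M :: ('a ^ 2 ^ 2) set. is_line M} sym_points = 4 * q"
proof -
  have char: "(1 :: 'a) + 1 = 0"
    using field_char_2[where ?'a = 'a and m = m] assms(1,2) by simp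
  let ?stop = "stopping_set H2 {M :: ('a ^ 2 ^ 2) set. is_line M} sym_points"
  let ?K = "small_word_support :: ('a ^ 2 ^ 2) set"
  have lower: "4 * q \<le> card T" if "?stop T" "T \<noteq> {}" for T
    using tangent_free_card_ge_4[OF char tangent_free_of_stopping_set[OF that(1)] that(2)]
    by (simp only: assms(1))
  have card_K: "card ?K = 4 * q"
    using card_small_word_support[where ?'a = 'a] by (simp only: assms(1))
  have K_ne: "?K \<noteq> {}"
  proof
    assume "?K = {}"
    then show False using card_K assms(2) by simp
  qed
  have K_sym: "?K \<subseteq> sym_points"
    by (auto simp: small_word_support_def)
  have even: "even (card {j \<in> ?K. H2 M j = 1})" if "M \<in> {M. is_line M}" for M
    unfolding H2_eq_1 using even_card_small_word_support_Int_line[OF char] that by blast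
  have K_stop: "?stop ?K"
    unfolding stopping_set_def
  proof (intro conjI ballI K_sym)
    fix M :: "('a ^ 2 ^ 2) set" assume "M \<in> {M. is_line M}"
    then show "card {j \<in> ?K. H2 M j = 1} \<noteq> 1"
      using even[of M] odd_one by metis
  qed
  have "stopping_distance H2 {M :: ('a ^ 2 ^ 2) set. is_line M} sym_points = 4 * q"
    unfolding stopping_distance_def
  proof (rule Min_eqI)
    show "finite {card T |T. ?stop T \<and> T \<noteq> {}}"
      by (rule finite_subset[of _ "range card"]) auto
    show "4 * q \<le> n" if "n \<in> {card T |T. ?stop T \<and> T \<noteq> {}}" for n
      using that lower by blast
    show "4 * q \<in> {card T |T. ?stop T \<and> T \<noteq> {}}"
      using K_stop K_ne card_K[symmetric] by blast
  qed
  moreover have "min_distance sym_points (C2 :: ('a ^ 2 ^ 2 \<Rightarrow> bit) set) = 4 * q"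
    unfolding min_distance_def
  proof (rule Min_eqI)
    show "finite {hamming_dist sym_points c d |c d. c \<in> (C2 :: ('a ^ 2 ^ 2 \<Rightarrow> bit) set) \<and> d \<in> C2 \<and> c \<noteq> d}"
      by (rule finite_subset[of _ "range (card :: ('a ^ 2 ^ 2) set \<Rightarrow> nat)"]) (auto simp: hamming_dist_def)
  next
    fix n assume "n \<in> {hamming_dist sym_points c d |c d. c \<in> (C2 :: ('a ^ 2 ^ 2 \<Rightarrow> bit) set) \<and> d \<in> C2 \<and> c \<noteq> d}"
    then obtain c d where n: "n = hamming_dist sym_points c d"
      and cd: "c \<in> (C2 :: ('a ^ 2 ^ 2 \<Rightarrow> bit) set)" "d \<in> C2" "c \<noteq> d"
      by blast
    have "c \<in> sym_points \<rightarrow>\<^sub>E UNIV" "d \<in> sym_points \<rightarrow>\<^sub>E UNIV"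
      using cd unfolding C2_def parity_check_code_def by blast+
    then have "{j \<in> sym_points. c j \<noteq> d j} \<noteq> {}"
      using cd(3) PiE_ext[of c sym_points "\<lambda>_. UNIV" d] by blast
    then show "4 * q \<le> n"
      unfolding n hamming_dist_def
      using lower[OF stopping_set_difference[OF _ cd(1,2)[unfolded C2_def]]] by simp
  next
    define c :: "'a ^ 2 ^ 2 \<Rightarrow> bit" where "c = restrict (\<lambda>j. of_bool (j \<in> ?K)) sym_points"
    \<comment> \<open>The zero word, in the same form as \<open>c\<close>, so that one lemma puts
      both words into the code.\<close>
    define d :: "'a ^ 2 ^ 2 \<Rightarrow> bit" where "d = restrict (\<lambda>j. of_bool (j \<in> {})) sym_points"
    have cd: "c \<in> C2" "d \<in> C2"
      unfolding C2_def c_def d_def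
      by (rule indicator_in_parity_check_code[OF _ K_sym even]; simp)
        (rule indicator_in_parity_check_code; simp)
    have iff: "c j \<noteq> d j \<longleftrightarrow> j \<in> ?K" if "j \<in> sym_points" for j
      unfolding c_def d_def
      using that by (simp only: restrict_apply' of_bool_eq_iff empty_iff simp_thms)
    then have diff: "{j \<in> sym_points. c j \<noteq> d j} = ?K"
      using K_sym by blast
    then have "c \<noteq> d"
      using K_ne by blast
    moreover have "4 * q = hamming_dist sym_points c d"
      by (simp only: hamming_dist_def diff card_K)
    ultimately show "4 * q \<in> {hamming_dist sym_points c d |c d. c \<in> (C2 :: ('a ^ 2 ^ 2 \<Rightarrow> bit) set) \<and> d \<in> C2 \<and> c \<noteq> d}"
      using cd by blast
  qed
  ultimately show ?thesis by blast
qed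

end
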